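(* Let $k\ge 1$ and $n\ge 0$ be integers and write $N=(2k+1)n+r$ with $0\le r\le 2k$. Then for $c$ an indeterminate, \[ \det_{0\leq i,j \leq N-1}\big(\mathrm{Cat}_{i+j+1,k}^{(1,c)}\big) = \begin{cases} \frac{F_{(2k+1)n}(c)}{F_{2k+1}(c)} + \frac{F_{(2k+1)(n+1)}(c)}{F_{2k+1}(c)}, & \text{if } r=0,\\[6pt] (-1)^{\binom{k}{2}}\left(\frac{F_{(2k+1)n}(c)}{F_{2k+1}(c)} + \frac{F_{(2k+1)(n+1)}(c)}{F_{2k+1}(c)}\right), & \text{if } r=k,\\[6pt] (-1)^{\binom{k+1}{2}}\big(L_k(c)+L_{k+1}(c)\big)\frac{F_{(2k+1)(n+1)}(c)}{F_{2k+1}(c)}, & \text{if } r=k+1,\\[6pt] (-1)^{k}\big(L_k(c)+L_{k+1}(c)\big)\frac{F_{(2k+1)(n+1)}(c)}{F_{2k+1}(c)}, & \text{if } r=2k,\\[6pt] 0, & \text{otherwise}. \end{cases} \] In addition, the $r=0$ and $r=k$ cases also hold when $k=0$; namely, for all integers $n\ge 0$, \[ \det_{0\leq i,j \leq n-1}\big(\mathrm{Cat}_{i+j+1,0}^{(1,c)}\big) = F_n(c) + F_{n+1}(c). \]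
   Context: For a sequence $(s_k)_{k\ge 0}$, let $\mathrm{Cat}_{n,k}^{(s)}$ be the array defined for $n\ge 1$, $k\ge 0$ by $\mathrm{Cat}_{n,k}^{(s)}=\mathrm{Cat}_{n-1,k-1}^{(s)}+s_k \mathrm{Cat}_{n-1,k}^{(s)}+\mathrm{Cat}_{n-1,k+1}^{(s)}$, with boundary values $\mathrm{Cat}_{0,0}^{(s)}=1$, $\mathrm{Cat}_{0,k}^{(s)}=0$ for $k\ge 1$, and $\mathrm{Cat}_{n,k}^{(s)}=0$ for $k<0$. For $b\in\{0,1\}$ write $\mathrm{Cat}_{n,k}^{(b,c)}$ for $\mathrm{Cat}_{n,k}^{(s)}$ with $s=(b+c,c,c,c,\ldots)$, i.e. $s_0=b+c$ and $s_k=c$ for $k\ge 1$. The polynomials $F_n(x)$ and $L_n(x)$ are defined by $F_0(x)=0$, $F_1(x)=1$, $F_n(x)=xF_{n-1}(x)-F_{n-2}(x)$ and $L_0(x)=2$, $L_1(x)=x$, $L_n(x)=xL_{n-1}(x)-L_{n-2}(x)$ for $n\ge 2$. The notation $\det_{0\le i,j\le N-1}(a_{i,j})$ is the determinant of the $N\times N$ matrix $(a_{i,j})$; the empty determinant ($N=0$) is $1$. *)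

theory Defs
  imports
    "Jordan_Normal_Form.Determinant"
    "HOL-Computational_Algebra.Polynomial_Factorial"
begin

text \<open>The second index is a natural number: the convention that the entries with negative second
  index vanish is built into the case \<open>k = 0\<close> of the recurrence.\<close>

fun Cat_array :: "(nat \<Rightarrow> 'a::comm_ring_1) \<Rightarrow> nat \<Rightarrow> nat \<Rightarrow> 'a" where
  "Cat_array s 0 k = (if k = 0 then 1 else 0)"
| "Cat_array s (Suc n) k =
     (if k = 0 then 0 else Cat_array s n (k - 1)) + s k * Cat_array s n k + Cat_array s n (k + 1)"

definition Cat :: "'a::comm_ring_1 \<Rightarrow> 'a \<Rightarrow> nat \<Rightarrow> nat \<Rightarrow> 'a" where
  "Cat b c n k = Cat_array (\<lambda>j. if j = 0 then b + c else c) n k"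

text \<open>The indeterminate is the variable of \<open>\<int>[c]\<close>, so \<open>F n\<close> and \<open>L n\<close> below are
  themselves \<open>F\<^sub>n(c)\<close> and \<open>L\<^sub>n(c)\<close>.\<close>

abbreviation indet :: "int poly" where
  "indet \<equiv> [:0, 1:]"

fun F :: "nat \<Rightarrow> int poly" where
  "F 0 = 0"
| "F (Suc 0) = 1"
| "F (Suc (Suc n)) = indet * F (Suc n) - F n"

fun L :: "nat \<Rightarrow> int poly" where
  "L 0 = 2"
| "L (Suc 0) = indet"
| "L (Suc (Suc n)) = indet * L (Suc n) - L n"

definition Cat_hankel_det :: "nat \<Rightarrow> nat \<Rightarrow> int poly" where
  "Cat_hankel_det k N = det (mat N N (\<lambda>(i, j). Cat 1 indet (i + j + 1) k))"

end

theory Submission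
  imports Defs
begin

text \<open>
  Let \<open>V\<^sub>0, V\<^sub>1, \<dots>\<close> be the monic polynomials in \<open>x\<close> that are orthonormal for the moments
  \<open>Cat 1 c n 0\<close>. They satisfy \<open>x V\<^sub>m = V\<^sub>m\<^sub>+\<^sub>1 + s\<^sub>m V\<^sub>m + V\<^sub>m\<^sub>-\<^sub>1\<close>, so \<open>Cat 1 c n k\<close> is the coefficient of \<open>V\<^sub>k\<close>
  in \<open>x\<^sup>n\<close>, equivalently the moment of \<open>x\<^sup>n V\<^sub>k\<close>. The matrix of the theorem is therefore the Hankel
  matrix of the moment functional multiplied by the polynomial \<open>q = x V\<^sub>k\<close> of degree \<open>k + 1\<close>. By a
  formula of Christoffel's type (\<open>det_hankel_eq_det_residues\<close>), its determinant is, up to the sign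
  \<open>(-1)\<^sup>N\<^sup>(\<^sup>k\<^sup>+\<^sup>1\<^sup>)\<close>, the determinant of size \<open>k + 1\<close> of the residues of \<open>V\<^sub>N, \<dots>, V\<^sub>N\<^sub>+\<^sub>k\<close> modulo \<open>q\<close>.

  The \<open>V\<^sub>m\<close> are Chebyshev polynomials of the third kind in \<open>x - c\<close>. Modulo \<open>V\<^sub>k\<close> they are antiperiodic
  in \<open>m\<close> with period \<open>2 k + 1\<close> and antisymmetric about \<open>m = k\<close>
  (\<open>Cat_poly_dvd_antiperiod\<close>, \<open>Cat_poly_dvd_reflection\<close>), so each \<open>V\<^sub>m\<close> is \<open>0\<close> or \<open>\<plusminus> V\<^sub>i\<close> with \<open>i < k\<close>. The
  remaining condition modulo \<open>x\<close> contributes one column, given by the values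
  \<open>V\<^sub>m(0) = (-1)\<^sup>m (F m + F (m + 1))\<close>. The residue matrix is so sparse that its determinant can be
  read off (\<open>Cat_hankel_det_cases\<close>): a window of \<open>k + 1\<close> consecutive indices either is degenerate, or
  hits each \<open>V\<^sub>i\<close> once and the zero \<open>V\<^sub>k\<close> once, or hits each \<open>V\<^sub>i\<close> once with \<open>V\<^sub>0\<close> repeated. The second and
  third possibilities leave a single value \<open>V\<^sub>m(0)\<close> and a difference \<open>V\<^sub>m\<^sub>+\<^sub>1(0) - V\<^sub>m(0)\<close> respectively,
  divided by \<open>V\<^sub>k(0)\<close>. Identities for \<open>F\<close> and \<open>L\<close> bring these quotients to the stated form.
\<close>

section \<open>Determinants of matrices and of families of polynomials\<close>

text \<open>Expanding along the first row contributes the sign \<open>(-1)\<^sup>n\<close> in passing from size \<open>n\<close>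
  to size \<open>n + 1\<close>, and \<open>0 + 1 + \<dots> + (n - 1)\<close> is the binomial coefficient.\<close>

lemma det_antidiag:
  "det (mat n n (\<lambda>(i, j). if i + j + 1 = n then 1 else 0 :: 'a::comm_ring_1)) = (- 1) ^ (n choose 2)"
proof (induction n)
  case (Suc n)
  let ?J = "\<lambda>n. mat n n (\<lambda>(i, j). if i + j + 1 = n then 1 else 0 :: 'a)"
  have minor: "mat_delete (?J (Suc n)) 0 n = ?J n"
    by (rule eq_matI) (auto simp: mat_delete_def)
  have "det (?J (Suc n)) = (\<Sum>j<Suc n. ?J (Suc n) $$ (0, j) * cofactor (?J (Suc n)) 0 j)"
    by (rule laplace_expansion_row) auto
  also have "\<dots> = (\<Sum>j<Suc n. if j = n then cofactor (?J (Suc n)) 0 n else 0)"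
    by (rule sum.cong) auto
  also have "\<dots> = (- 1) ^ n * (- 1) ^ (n choose 2)"
    unfolding cofactor_def minor Suc.IH by simp
  also have "\<dots> = (- 1) ^ (Suc n choose 2)"
    by (simp add: numeral_2_eq_2 power_add)
  finally show ?case .
qed (simp add: numeral_2_eq_2)

lemma det_reverse_rows:
  fixes a :: "nat \<Rightarrow> nat \<Rightarrow> 'a::comm_ring_1"
  shows "det (mat n n (\<lambda>(i, j). a i j)) = (- 1) ^ (n choose 2) * det (mat n n (\<lambda>(i, j). a (n - 1 - i) j))"
proof -
  let ?J = "mat n n (\<lambda>(i, j). if i + j + 1 = n then 1 else 0 :: 'a)"
  let ?B = "mat n n (\<lambda>(i, j). a (n - 1 - i) j)"
  have "mat n n (\<lambda>(i, j). a i j) = ?J * ?B"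
  proof (rule eq_matI)
    fix i j assume ij: "i < dim_row (?J * ?B)" "j < dim_col (?J * ?B)"
    hence "(?J * ?B) $$ (i, j) = (\<Sum>l = 0..<n. (if i + l + 1 = n then 1 else 0) * a (n - 1 - l) j)"
      by (simp add: scalar_prod_def)
    also have "\<dots> = (\<Sum>l = 0..<n. if l = n - 1 - i then a i j else 0)"
      using ij by (intro sum.cong) auto
    finally show "mat n n (\<lambda>(i, j). a i j) $$ (i, j) = (?J * ?B) $$ (i, j)"
      using ij by simp
  qed auto
  moreover have "det (?J * ?B) = det ?J * det ?B"
    by (rule det_mult[of _ n]) auto
  ultimately show ?thesis
    by (simp only: det_antidiag)
qed

text \<open>The easy half of the Frobenius-Koenig theorem: a permutation cannot map the rows \<open>I\<close> into the
  smaller set of columns \<open>S\<close>, so each term of the Leibniz expansion contains a zero entry.\<close>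

lemma det_eq_0_if_zero_block:
  fixes A :: "'a::comm_ring_1 mat"
  assumes A: "A \<in> carrier_mat n n" and I: "I \<subseteq> {0..<n}" and S: "finite S" "card S < card I"
    and zero: "\<And>i j. i \<in> I \<Longrightarrow> j < n \<Longrightarrow> j \<notin> S \<Longrightarrow> A $$ (i, j) = 0"
  shows "det A = 0"
  unfolding det_def'[OF A]
proof (rule sum.neutral, clarsimp)
  fix p assume p: "p permutes {0..<n}"
  have "card (p ` I) = card I"
    using permutes_inj_on[OF p] by (rule card_image)
  hence "\<not> p ` I \<subseteq> S"
    using S card_mono[of S "p ` I"] by (metis leD)
  then obtain i where i: "i \<in> I" "p i \<notin> S" by blast
  hence "i < n" "p i < n"
    using I permutes_in_image[OF p] by auto
  hence "(\<Prod>i = 0..<n. A $$ (i, p i)) = 0"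
    using i by (intro prod_zero) (auto intro!: zero)
  thus "signof p * (\<Prod>i = 0..<n. A $$ (i, p i)) = 0"
    by simp
qed

text \<open>The coefficient matrix of monic polynomials of degrees \<open>0, 1, 2, \<dots>\<close> is unitriangular. Hence the
  determinant of the coordinates of a family of polynomials is the same in all such bases, which
  is what allows one determinant to be evaluated in two different bases below.\<close>

lemma det_monic_basis_change:
  fixes f g :: "nat \<Rightarrow> 'a::comm_ring_1 poly"
  assumes g: "\<And>j. j < n \<Longrightarrow> degree (g j) = j" "\<And>j. j < n \<Longrightarrow> lead_coeff (g j) = 1"
    and f: "\<And>i. i < n \<Longrightarrow> f i = (\<Sum>j<n. smult (a i j) (g j))"
  shows "det (mat n n (\<lambda>(i, j). a i j)) = det (mat n n (\<lambda>(i, j). coeff (f i) j))"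
proof -
  let ?A = "mat n n (\<lambda>(i, j). a i j)" and ?G = "mat n n (\<lambda>(i, j). coeff (g i) j)"
  have "det ?G = prod_list (diag_mat ?G)"
    by (rule det_lower_triangular[of n]) (auto simp: coeff_eq_0 g)
  also have "diag_mat ?G = map (\<lambda>i. 1) [0..<n]"
    unfolding diag_mat_def using g by (auto intro!: map_cong)
  also have "prod_list (map (\<lambda>i. 1) [0..<n]) = (1::'a)"
    by (induction n) auto
  finally have G: "det ?G = 1" .
  have "mat n n (\<lambda>(i, j). coeff (f i) j) = ?A * ?G"
    by (rule eq_matI) (auto simp: f scalar_prod_def coeff_sum atLeast0LessThan)
  moreover have "det (?A * ?G) = det ?A * det ?G"
    by (rule det_mult[of _ n]) auto
  ultimately show ?thesis
    by (simp add: G)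
qed

lemma monic_basis_expansion:
  fixes f :: "'a::comm_ring_1 poly" and g :: "nat \<Rightarrow> 'a poly"
  assumes g: "\<And>j. j < n \<Longrightarrow> degree (g j) = j" "\<And>j. j < n \<Longrightarrow> lead_coeff (g j) = 1"
    and f: "\<And>j. j \<ge> n \<Longrightarrow> coeff f j = 0"
  obtains a where "f = (\<Sum>j<n. smult (a j) (g j))"
proof -
  have "\<exists>a. f = (\<Sum>j<n. smult (a j) (g j))"
    using assms
  proof (induction n arbitrary: f)
    case 0
    thus ?case by (auto intro: poly_eqI)
  next
    case (Suc n)
    let ?h = "f - smult (coeff f n) (g n)"
    have "coeff ?h j = 0" if "j \<ge> n" for j
    proof (cases "j = n")
      case True
      thus ?thesis using Suc.prems(1,2)[of n] by simp
    next
      case False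
      thus ?thesis using Suc.prems(1)[of n] Suc.prems(3)[of j] that by (simp add: coeff_eq_0)
    qed
    then obtain a where "?h = (\<Sum>j<n. smult (a j) (g j))"
      using Suc.IH[of ?h] Suc.prems(1,2) by (meson less_Suc_eq)
    hence "f = (\<Sum>j<Suc n. smult ((a(n := coeff f n)) j) (g j))"
      by (simp add: algebra_simps)
    thus ?case by blast
  qed
  with that show thesis by blast
qed

section \<open>The Catalan array and its orthogonal polynomials\<close>

fun orth_poly :: "(nat \<Rightarrow> 'a::comm_ring_1) \<Rightarrow> nat \<Rightarrow> 'a poly" where
  "orth_poly s 0 = 1"
| "orth_poly s (Suc 0) = [:- s 0, 1:]"
| "orth_poly s (Suc (Suc n)) = [:- s (Suc n), 1:] * orth_poly s (Suc n) - orth_poly s n"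

text \<open>The polynomials \<open>orth_poly s k\<close> are those for which \<open>x P\<^sub>k = P\<^sub>k\<^sub>+\<^sub>1 + s\<^sub>k P\<^sub>k + P\<^sub>k\<^sub>-\<^sub>1\<close> with \<open>P\<^sub>-\<^sub>1 = 0\<close>, so that
  multiplication by \<open>x\<close> acts on coordinates with respect to them as the recurrence of the Catalan
  array does. The functional below sends \<open>x\<^sup>n\<close> to the array entry with indices \<open>n, k\<close>; it turns out
  to be the coefficient of \<open>P\<^sub>k\<close> in that basis. The case \<open>k = 0\<close> is the moment functional for which
  the \<open>P\<^sub>k\<close> are orthonormal.\<close>

definition Cat_coord :: "(nat \<Rightarrow> 'a::comm_ring_1) \<Rightarrow> nat \<Rightarrow> 'a poly \<Rightarrow> 'a" where
  "Cat_coord s k f = (\<Sum>n\<le>degree f. coeff f n * Cat_array s n k)"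

lemma orth_poly_monic:
  fixes s :: "nat \<Rightarrow> 'a::comm_ring_1"
  shows "degree (orth_poly s n) = n \<and> coeff (orth_poly s n) n = 1"
proof (induction s n rule: orth_poly.induct)
  case (3 s n)
  have below: "coeff (orth_poly s n) j = 0" if "j > n" for j
    using 3 that by (simp add: coeff_eq_0)
  have below': "coeff (orth_poly s (Suc n)) j = 0" if "j > Suc n" for j
    using 3 that by (simp add: coeff_eq_0)
  have top: "coeff (orth_poly s (Suc (Suc n))) (Suc (Suc n)) = 1"
    using 3 below below' by (simp add: coeff_eq_0)
  have "coeff (orth_poly s (Suc (Suc n))) j = 0" if "j > Suc (Suc n)" for j
    using below below' that by (cases j) auto
  hence "degree (orth_poly s (Suc (Suc n))) \<le> Suc (Suc n)"
    by (intro degree_le) auto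
  moreover have "degree (orth_poly s (Suc (Suc n))) \<ge> Suc (Suc n)"
    using top by (intro le_degree) simp
  ultimately have "degree (orth_poly s (Suc (Suc n))) = Suc (Suc n)"
    by (rule le_antisym)
  thus ?case using top by (rule conjI)
qed auto

lemma degree_orth_poly [simp]: "degree (orth_poly s n) = n"
  and coeff_orth_poly_top [simp]: "coeff (orth_poly s n) n = 1"
  using orth_poly_monic by blast+

lemma Cat_array_eq_0: "n < k \<Longrightarrow> Cat_array s n k = 0"
  by (induction s n k rule: Cat_array.induct) auto

lemma Cat_array_diag: "Cat_array s n n = 1"
  by (induction n) (auto simp: Cat_array_eq_0)

lemma Cat_coord_eq_sum:
  "degree f \<le> n \<Longrightarrow> Cat_coord s k f = (\<Sum>i\<le>n. coeff f i * Cat_array s i k)"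
  unfolding Cat_coord_def by (rule sum.mono_neutral_left) (auto simp: coeff_eq_0)

lemma Cat_coord_add: "Cat_coord s k (f + g) = Cat_coord s k f + Cat_coord s k g"
  using Cat_coord_eq_sum[of f "max (degree f) (degree g)" s k]
    Cat_coord_eq_sum[of g "max (degree f) (degree g)" s k]
    Cat_coord_eq_sum[of "f + g" "max (degree f) (degree g)" s k]
  by (simp add: degree_add_le_max sum.distrib algebra_simps)

lemma Cat_coord_smult: "Cat_coord s k (smult a f) = a * Cat_coord s k f"
  using Cat_coord_eq_sum[of "smult a f" "degree f" s k]
  by (simp add: Cat_coord_def degree_smult_le sum_distrib_left mult.assoc)

lemma Cat_coord_diff: "Cat_coord s k (f - g) = Cat_coord s k f - Cat_coord s k g"
  using Cat_coord_add[of s k f "smult (-1) g"] Cat_coord_smult[of s k "-1" g] by simp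

lemma Cat_coord_sum: "Cat_coord s k (\<Sum>i\<in>A. f i) = (\<Sum>i\<in>A. Cat_coord s k (f i))"
  by (induction A rule: infinite_finite_induct) (auto simp: Cat_coord_add, auto simp: Cat_coord_def)

lemma Cat_coord_monom: "Cat_coord s k (monom 1 n) = Cat_array s n k"
proof -
  have "Cat_coord s k (monom 1 n) = (\<Sum>i\<le>n. coeff (monom 1 n) i * Cat_array s i k)"
    by (rule Cat_coord_eq_sum) (simp add: degree_monom_le)
  also have "\<dots> = (\<Sum>i\<le>n. if i = n then Cat_array s n k else 0)"
    by (rule sum.cong) auto
  finally show ?thesis by simp
qed

lemma Cat_coord_pCons_0:
  "Cat_coord s k (pCons 0 f) =
     (if k = 0 then 0 else Cat_coord s (k - 1) f) + s k * Cat_coord s k f + Cat_coord s (k + 1) f"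
proof -
  have "Cat_coord s k (pCons 0 f) =
      (\<Sum>i\<le>Suc (degree f). coeff (pCons 0 f) i * Cat_array s i k)"
    by (rule Cat_coord_eq_sum) (simp add: degree_pCons_le)
  also have "\<dots> = (\<Sum>i\<le>degree f. coeff f i * Cat_array s (Suc i) k)"
    by (simp add: sum.atMost_Suc_shift del: Cat_array.simps sum.atMost_Suc)
  finally show ?thesis
    by (auto simp: Cat_coord_def algebra_simps sum.distrib sum_distrib_left)
qed

lemma Cat_coord_linear_factor:
  "Cat_coord s k ([:- a, 1:] * f) =
     (if k = 0 then 0 else Cat_coord s (k - 1) f) + (s k - a) * Cat_coord s k f + Cat_coord s (k + 1) f"
proof -
  have "[:- a, 1:] * f = pCons 0 f - smult a f" by simp
  thus ?thesis
    by (simp only: Cat_coord_diff Cat_coord_smult Cat_coord_pCons_0) (simp add: algebra_simps)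
qed

lemma Cat_coord_orth_poly: "Cat_coord s k (orth_poly s n) = (if n = k then 1 else 0)"
proof (induction s n arbitrary: k rule: orth_poly.induct)
  case (1 s)
  thus ?case by (simp add: Cat_coord_def)
next
  case (2 s)
  thus ?case by (auto simp: Cat_coord_def)
next
  case (3 s n)
  show ?case
    unfolding orth_poly.simps(3) Cat_coord_diff Cat_coord_linear_factor 3
    by (cases k) auto
qed

text \<open>Multiplication by a polynomial is a self-adjoint operator in the orthonormal basis of the \<open>P\<^sub>k\<close>:
  the coefficient of \<open>P\<^sub>k\<close> in \<open>f P\<^sub>0\<close> is the coefficient of \<open>P\<^sub>0\<close> in \<open>f P\<^sub>k\<close>. In particular the
  entries in column \<open>k\<close> of the Catalan array are moments for the functional with weight \<open>P\<^sub>k\<close>.\<close>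

lemma Cat_coord_eq_Cat_coord_0:
  "Cat_coord s k f = Cat_coord s 0 (f * orth_poly s k)"
proof (induction s k arbitrary: f rule: orth_poly.induct)
  case (2 s)
  have "f * orth_poly s (Suc 0) = [:- s 0, 1:] * f"
    by (simp only: orth_poly.simps mult.commute)
  thus ?case by (simp only: Cat_coord_linear_factor) simp
next
  case (3 s n)
  have "f * orth_poly s (Suc (Suc n)) =
      ([:- s (Suc n), 1:] * f) * orth_poly s (Suc n) - f * orth_poly s n"
    by (simp only: orth_poly.simps algebra_simps)
  thus ?case
    by (simp only: Cat_coord_diff 3[symmetric] Cat_coord_linear_factor) simp
qed auto

lemma orth_poly_expansion:
  assumes "\<And>j. j \<ge> n \<Longrightarrow> coeff f j = 0"
  shows "f = (\<Sum>j<n. smult (Cat_coord s j f) (orth_poly s j))"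
proof -
  obtain a where a: "f = (\<Sum>j<n. smult (a j) (orth_poly s j))"
    by (rule monic_basis_expansion[of n "orth_poly s" f]) (auto simp: assms)
  have "Cat_coord s i f = a i" if "i < n" for i
  proof -
    have "Cat_coord s i f = (\<Sum>j<n. if j = i then a i else 0)"
      unfolding a Cat_coord_sum Cat_coord_smult Cat_coord_orth_poly by (rule sum.cong) auto
    thus ?thesis using that by simp
  qed
  thus ?thesis using a by simp
qed

section \<open>Hankel determinants as determinants of residues\<close>

text \<open>An algebraic form of Christoffel's formula for the moments of a functional that is multiplied by a
  polynomial \<open>q\<close> of degree \<open>d\<close>: the \<open>N \<times> N\<close> Hankel determinant equals, up to sign, the \<open>d \<times> d\<close>
  determinant of the residues of \<open>P\<^sub>N, \<dots>, P\<^sub>N\<^sub>+\<^sub>d\<^sub>-\<^sub>1\<close> modulo \<open>q\<close>.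

  Both are the determinant of the family \<open>q, q x, \<dots>, q x\<^sup>N\<^sup>-\<^sup>1, P\<^sub>N, \<dots>, P\<^sub>N\<^sub>+\<^sub>d\<^sub>-\<^sub>1\<close> of polynomials of degree less than \<open>N + d\<close>. In the basis
  \<open>P\<^sub>0, P\<^sub>1, \<dots>\<close> the last \<open>d\<close> rows are unit vectors, and what remains is the Hankel matrix after a
  unitriangular change of columns. In the basis \<open>g\<^sub>0, \<dots>, g\<^sub>d\<^sub>-\<^sub>1, q, q x, \<dots>\<close> the first \<open>N\<close> rows are unit
  vectors, and what remains are the residues; the sign comes from moving \<open>N\<close> rows past \<open>d\<close> rows.\<close>

lemma det_hankel_eq_det_residues:
  fixes s :: "nat \<Rightarrow> 'a::idom" and q :: "'a poly"
  assumes q: "degree q = d" "lead_coeff q = 1"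
    and g: "\<And>j. j < d \<Longrightarrow> degree (g j) = j" "\<And>j. j < d \<Longrightarrow> lead_coeff (g j) = 1"
    and residue: "\<And>i. i < d \<Longrightarrow> orth_poly s (N + i) = (\<Sum>j<d. smult (r i j) (g j)) + q * h i"
  shows "det (mat N N (\<lambda>(i, j). Cat_coord s 0 (q * monom 1 (i + j)))) =
    (- 1) ^ (N * d) * det (mat d d (\<lambda>(i, j). r i j))"
proof -
  \<comment> \<open>The family of polynomials, the second basis, and the coordinates of the former in the latter.\<close>
  define f where "f i = (if i < N then q * monom 1 i else orth_poly s i)" for i
  define b where "b j = (if j < d then g j else q * monom 1 (j - d))" for j
  define e where "e i j = (if i < N then if j = d + i then 1 else 0
    else if j < d then r (i - N) j else coeff (h (i - N)) (j - d))" for i j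
  have q0: "q \<noteq> 0" using q by auto
  have degree_q: "degree (q * monom 1 i) = d + i" for i
    using q0 q by (subst degree_mult_eq) (auto simp: degree_monom_eq)
  have lead_q: "lead_coeff (q * monom 1 i) = 1" for i
    unfolding lead_coeff_mult using q by (simp add: degree_monom_eq)
  have coeff_f: "coeff (f i) j = 0" if "i < N + d" "j \<ge> N + d" for i j
    using that degree_q[of i] by (auto simp: f_def intro!: coeff_eq_0)
  have coeff_h: "coeff (h i) l = 0" if i: "i < d" and l: "l \<ge> N" for i l
  proof (cases "h i = 0")
    case False
    have "q * h i = orth_poly s (N + i) - (\<Sum>j<d. smult (r i j) (g j))"
      using residue[OF i] by simp
    moreover have "degree (\<Sum>j<d. smult (r i j) (g j)) < N + d"
      using i g by (intro degree_sum_less) (auto intro: le_less_trans[OF degree_smult_le])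
    ultimately have "degree (q * h i) < N + d"
      using i by (auto intro!: degree_diff_less)
    hence "degree (h i) < N"
      using q q0 False by (simp add: degree_mult_eq)
    thus ?thesis using l by (simp add: coeff_eq_0)
  qed simp

  have "det (mat (N + d) (N + d) (\<lambda>(i, j). Cat_coord s j (f i))) =
      det (mat (N + d) (N + d) (\<lambda>(i, j). coeff (f i) j))"
    by (rule det_monic_basis_change[where g = "orth_poly s"])
       (auto intro!: orth_poly_expansion coeff_f)
  moreover have "det (mat (N + d) (N + d) (\<lambda>(i, j). e i j)) =
      det (mat (N + d) (N + d) (\<lambda>(i, j). coeff (f i) j))"
  proof (rule det_monic_basis_change[where g = b])
    fix j assume "j < N + d"
    show "degree (b j) = j"
      using g(1) degree_q[of "j - d"] by (auto simp: b_def)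
    show "lead_coeff (b j) = 1"
      using g(2)[of j] lead_q[of "j - d"] unfolding b_def by presburger
  next
    fix i assume i: "i < N + d"
    have "(\<Sum>j<d + N. w j) = (\<Sum>j<d. w j) + (\<Sum>l<N. w (d + l))" for w :: "nat \<Rightarrow> 'a poly"
      by (induction N) (auto simp: add.assoc)
    from this[of "\<lambda>j. smult (e i j) (b j)"]
    have split: "(\<Sum>j<N + d. smult (e i j) (b j)) =
        (\<Sum>j<d. smult (e i j) (g j)) + (\<Sum>l<N. smult (e i (d + l)) (q * monom 1 l))"
      by (simp add: b_def add.commute[of N d])
    show "f i = (\<Sum>j<N + d. smult (e i j) (b j))"
    proof (cases "i < N")
      case True
      have "(\<Sum>l<N. smult (e i (d + l)) (q * monom 1 l)) =
          (\<Sum>l<N. if l = i then q * monom 1 i else 0)"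
        using True by (intro sum.cong) (auto simp: e_def)
      thus ?thesis
        unfolding split using True by (simp add: f_def e_def)
    next
      case False
      hence i': "i - N < d" using i by simp
      have "h (i - N) = (\<Sum>l<N. smult (coeff (h (i - N)) l) (monom 1 l))"
        using coeff_h[OF i'] by (intro poly_eqI) (auto simp: smult_monom coeff_sum not_less)
      hence "q * h (i - N) = (\<Sum>l<N. smult (coeff (h (i - N)) l) (q * monom 1 l))"
        by (metis (no_types, lifting) mult_smult_right sum.cong sum_distrib_left)
      thus ?thesis
        unfolding split using False residue[OF i'] by (simp add: f_def e_def)
    qed
  qed
  ultimately have two_expansions: "det (mat (N + d) (N + d) (\<lambda>(i, j). Cat_coord s j (f i))) =
      det (mat (N + d) (N + d) (\<lambda>(i, j). e i j))"
    by simp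

  \<comment> \<open>The coordinates of \<open>x\<^sup>j\<close> for \<open>j < N\<close> turn the columns of the Hankel matrix into coordinates
    of the \<open>q x\<^sup>i\<close>.\<close>
  let ?H = "mat N N (\<lambda>(i, j). Cat_coord s 0 (q * monom 1 (i + j)))"
  let ?G = "mat N N (\<lambda>(i, j). Cat_coord s j (q * monom 1 i))"
  let ?A = "mat N N (\<lambda>(m, j). Cat_array s j m)"
  have "?H = ?G * ?A"
  proof (rule eq_matI)
    fix i j assume ij: "i < dim_row (?G * ?A)" "j < dim_col (?G * ?A)"
    have "monom 1 j = (\<Sum>m<N. smult (Cat_array s j m) (orth_poly s m))"
      using orth_poly_expansion[of N "monom 1 j" s] ij by (simp add: Cat_coord_monom)
    hence "q * monom 1 (i + j) =
        (\<Sum>m<N. smult (Cat_array s j m) (q * monom 1 i * orth_poly s m))"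
      by (metis (no_types, lifting) mult.assoc mult_1 mult_monom mult_smult_right sum.cong
          sum_distrib_left)
    hence "Cat_coord s 0 (q * monom 1 (i + j)) =
        (\<Sum>m<N. Cat_array s j m * Cat_coord s m (q * monom 1 i))"
      by (simp only: Cat_coord_sum Cat_coord_smult Cat_coord_eq_Cat_coord_0[symmetric])
    thus "?H $$ (i, j) = (?G * ?A) $$ (i, j)"
      using ij by (simp add: scalar_prod_def atLeast0LessThan mult.commute)
  qed auto
  moreover have "det (?G * ?A) = det ?G * det ?A"
    by (rule det_mult[of _ N]) auto
  moreover have "det ?A = prod_list (diag_mat ?A)"
    by (rule det_upper_triangular[of _ N]) (auto simp: Cat_array_eq_0)
  moreover have "diag_mat ?A = map (\<lambda>i. 1) [0..<N]"
    unfolding diag_mat_def by (auto simp: Cat_array_diag)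
  moreover have "prod_list (map (\<lambda>i. 1) [0..<N]) = (1::'a)"
    by (induction N) auto
  ultimately have "det ?H = det ?G"
    by simp
  also have "mat (N + d) (N + d) (\<lambda>(i, j). Cat_coord s j (f i)) =
      four_block_mat ?G (mat N d (\<lambda>(i, j). Cat_coord s (N + j) (f i))) (0\<^sub>m d N) (1\<^sub>m d)"
    by (rule eq_matI) (auto simp: f_def Cat_coord_orth_poly)
  hence "det ?G = det (mat (N + d) (N + d) (\<lambda>(i, j). Cat_coord s j (f i)))"
    by (simp add: det_four_block_mat_lower_left_zero[of ?G N _ d])
  also have "\<dots> = det (mat (N + d) (N + d) (\<lambda>(i, j). e i j))"
    by (rule two_expansions)
  also have "\<dots> = (- 1) ^ (N * d) *
      det (mat (N + d) (N + d) (\<lambda>(i, j). e (if i < d then i + N else i - d) j))"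
    by (subst det_swap_initial_rows[of _ "N + d" N d]) (auto intro!: arg_cong[where f = det] eq_matI)
  also have "mat (N + d) (N + d) (\<lambda>(i, j). e (if i < d then i + N else i - d) j) =
      four_block_mat (mat d d (\<lambda>(i, j). r i j)) (mat d N (\<lambda>(i, j). coeff (h i) j))
        (0\<^sub>m N d) (1\<^sub>m N)"
    by (rule eq_matI) (auto simp: e_def)
  also have "det \<dots> = det (mat d d (\<lambda>(i, j). r i j))"
    by (simp add: det_four_block_mat_lower_left_zero[of _ d _ N])
  finally show ?thesis .
qed

section \<open>Residues of the Chebyshev polynomials\<close>

text \<open>With \<open>x - c = 2 cos \<theta>\<close> the polynomial \<open>Cat_poly c m\<close> is \<open>cos ((2 m + 1) \<theta> / 2) / cos (\<theta> / 2)\<close>,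
  a Chebyshev polynomial of the third kind. The next lemmas are the resulting symmetries of
  \<open>m \<mapsto> cos ((2 m + 1) \<theta> / 2)\<close> at the zeros of \<open>Cat_poly c k\<close>, stated as divisibilities and proved
  from the three-term recurrence over an arbitrary commutative ring.\<close>

definition Cat_poly :: "'a::comm_ring_1 \<Rightarrow> nat \<Rightarrow> 'a poly" where
  "Cat_poly c = orth_poly (\<lambda>j. if j = 0 then 1 + c else c)"

text \<open>The factor \<open>X\<close> is \<open>x - c\<close>; it is kept abstract so that simplification does not expand products
  with an explicit linear polynomial.\<close>

lemma Cat_poly_recurrence:
  obtains X where "Cat_poly c 0 = 1" "Cat_poly c (Suc 0) = X - 1"
    "\<And>m. Cat_poly c (Suc (Suc m)) = X * Cat_poly c (Suc m) - Cat_poly c m"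
  by (rule that[of "[:- c, 1:]"]) (simp_all add: Cat_poly_def one_pCons)

lemma Cat_poly_dvd_reflection:
  assumes "j \<le> k"
  shows "Cat_poly c k dvd Cat_poly c (k + j) + Cat_poly c (k - j)"
proof -
  obtain X where X: "Cat_poly c 0 = 1" "Cat_poly c (Suc 0) = X - 1"
      "\<And>m. Cat_poly c (Suc (Suc m)) = X * Cat_poly c (Suc m) - Cat_poly c m"
    by (rule Cat_poly_recurrence[of c]) blast
  from assms show ?thesis
  proof (induction j rule: induct_nat_012)
    case 0
    thus ?case by (simp add: dvd_add)
  next
    case 1
    then obtain l where l: "k = Suc l" by (cases k) auto
    have "Cat_poly c (k + Suc 0) + Cat_poly c (k - Suc 0) = X * Cat_poly c k"
      unfolding l by (simp add: X)
    thus ?case by (simp only: dvd_triv_right)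
  next
    case (ge2 j)
    define l where "l = k - Suc (Suc j)"
    hence l: "k - j = Suc (Suc l)" "k - Suc j = Suc l" "k - Suc (Suc j) = l"
      using ge2.prems by auto
    have "Cat_poly c (k + Suc (Suc j)) + Cat_poly c (k - Suc (Suc j)) =
        X * (Cat_poly c (k + Suc j) + Cat_poly c (k - Suc j))
        - (Cat_poly c (k + j) + Cat_poly c (k - j))"
      unfolding l by (simp add: X algebra_simps)
    also have "Cat_poly c k dvd \<dots>"
      using ge2 by (intro dvd_diff dvd_mult) auto
    finally show ?case .
  qed
qed

lemma Cat_poly_dvd_antiperiod:
  "Cat_poly c k dvd Cat_poly c (m + (2 * k + 1)) + Cat_poly c m"
proof -
  obtain X where X: "Cat_poly c 0 = 1" "Cat_poly c (Suc 0) = X - 1"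
      "\<And>m. Cat_poly c (Suc (Suc m)) = X * Cat_poly c (Suc m) - Cat_poly c m"
    by (rule Cat_poly_recurrence[of c]) blast
  have base: "Cat_poly c k dvd Cat_poly c (0 + (2 * k + 1)) + Cat_poly c 0"
  proof (cases k)
    case (Suc l)
    have "Cat_poly c (0 + (2 * k + 1)) + Cat_poly c 0 =
        X * (Cat_poly c (k + k) + Cat_poly c (k - k))
        - (Cat_poly c (k + l) + Cat_poly c (k - l))"
      using Suc by (simp add: X algebra_simps mult_2 mult_2_right)
    also have "Cat_poly c k dvd \<dots>"
      using Suc by (intro dvd_diff dvd_mult Cat_poly_dvd_reflection) auto
    finally show ?thesis .
  qed (simp add: X)
  show ?thesis
  proof (induction m rule: induct_nat_012)
    case 0
    show ?case by (rule base)
  next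
    case 1
    have "Cat_poly c (Suc 0 + (2 * k + 1)) + Cat_poly c (Suc 0) =
        X * (Cat_poly c (0 + (2 * k + 1)) + Cat_poly c 0)
        - (Cat_poly c (k + k) + Cat_poly c (k - k))"
      by (simp add: X algebra_simps mult_2 mult_2_right)
    also have "Cat_poly c k dvd \<dots>"
      using base by (intro dvd_diff dvd_mult Cat_poly_dvd_reflection) auto
    finally show ?case .
  next
    case (ge2 m)
    have "Cat_poly c (Suc (Suc m) + (2 * k + 1)) + Cat_poly c (Suc (Suc m)) =
        X * (Cat_poly c (Suc m + (2 * k + 1)) + Cat_poly c (Suc m))
        - (Cat_poly c (m + (2 * k + 1)) + Cat_poly c m)"
      by (simp add: X algebra_simps)
    also have "Cat_poly c k dvd \<dots>"
      using ge2 by (intro dvd_diff dvd_mult) auto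
    finally show ?case .
  qed
qed

text \<open>For \<open>m \<le> 3 k\<close>, the reflection at \<open>k\<close> and the antiperiod \<open>2 k + 1\<close> fold \<open>Cat_poly c m\<close> modulo
  \<open>Cat_poly c k\<close> to \<open>0\<close> or to \<open>\<plusminus> Cat_poly c i\<close> with \<open>i < k\<close>. The sequence of folded indices is
  \<open>0, \<dots>, k - 1\<close>, then the zero at \<open>k\<close>, then \<open>k - 1, \<dots>, 0\<close> and \<open>0, \<dots>, k - 1\<close> with negative sign.\<close>

definition fold_sign :: "nat \<Rightarrow> nat \<Rightarrow> 'a::comm_ring_1" where
  "fold_sign k m = (if m < k then 1 else if m = k then 0 else - 1)"

definition fold_index :: "nat \<Rightarrow> nat \<Rightarrow> nat" where
  "fold_index k m = (if m < k then m else if m \<le> 2 * k then 2 * k - m else m - (2 * k + 1))"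

lemma Cat_poly_dvd_fold:
  assumes "m \<le> 3 * k"
  shows "Cat_poly c k dvd
    Cat_poly c ((2 * k + 1) * n + m) - smult ((- 1) ^ n * fold_sign k m) (Cat_poly c (fold_index k m))"
proof (induction n)
  case 0
  consider "m < k" | "m = k" | "k < m" "m \<le> 2 * k" | "2 * k < m" by linarith
  thus ?case
  proof cases
    case 3
    thus ?thesis
      using Cat_poly_dvd_reflection[of "m - k" k c] by (simp add: fold_sign_def fold_index_def mult_2)
  next
    case 4
    thus ?thesis
      using Cat_poly_dvd_antiperiod[of c k "m - (2 * k + 1)"]
      by (simp add: fold_sign_def fold_index_def)
  qed (auto simp: fold_sign_def fold_index_def)
next
  case (Suc n)
  let ?R = "smult ((- 1) ^ n * fold_sign k m) (Cat_poly c (fold_index k m))"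
  have "Cat_poly c ((2 * k + 1) * Suc n + m)
        - smult ((- 1) ^ Suc n * fold_sign k m) (Cat_poly c (fold_index k m)) =
      (Cat_poly c (((2 * k + 1) * n + m) + (2 * k + 1)) + Cat_poly c ((2 * k + 1) * n + m))
      - (Cat_poly c ((2 * k + 1) * n + m) - ?R)"
    by (simp add: add_ac)
  also have "Cat_poly c k dvd \<dots>"
    using Suc.IH Cat_poly_dvd_antiperiod by (rule dvd_diff[rotated])
  finally show ?case .
qed

text \<open>Column \<open>k\<close> of the Catalan array, shifted by one, consists of the moments for the weight
  \<open>q = x V\<^sub>k\<close>, where \<open>V\<^sub>m\<close> is \<open>Cat_poly c m\<close>. In the basis \<open>V\<^sub>0, \<dots>, V\<^sub>k\<close> of the residues modulo \<open>q\<close>, the row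
  of \<open>V\<^sub>N\<^sub>+\<^sub>i\<close> has one entry from folding modulo \<open>V\<^sub>k\<close> and a last entry \<open>\<eta> i\<close> that evaluation at
  \<open>0\<close> determines if \<open>V\<^sub>k(0) \<noteq> 0\<close>.\<close>

lemma Cat_hankel_residues:
  fixes c :: "'a::idom"
  assumes N: "N = (2 * k + 1) * n + r" and r: "r \<le> 2 * k"
  obtains \<eta> where
    "\<And>i. i \<le> k \<Longrightarrow> poly (Cat_poly c (N + i)) 0 =
      (- 1) ^ n * fold_sign k (r + i) * poly (Cat_poly c (fold_index k (r + i))) 0
      + poly (Cat_poly c k) 0 * \<eta> i"
    "det (mat N N (\<lambda>(i, j). Cat 1 c (i + j + 1) k)) = (- 1) ^ (N * (k + 1)) *
      det (mat (k + 1) (k + 1) (\<lambda>(i, j). if j = k then \<eta> i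
        else if j = fold_index k (r + i) then (- 1) ^ n * fold_sign k (r + i) else 0))"
proof -
  let ?V = "Cat_poly c"
  let ?s = "\<lambda>j. if j = 0 then 1 + c else c :: 'a"
  define \<sigma> :: "nat \<Rightarrow> 'a" where "\<sigma> i = (- 1) ^ n * fold_sign k (r + i)" for i
  define \<tau> where "\<tau> i = fold_index k (r + i)" for i
  have "\<forall>i\<in>{..k}. \<exists>h. ?V (N + i) - smult (\<sigma> i) (?V (\<tau> i)) = ?V k * h"
  proof
    fix i assume "i \<in> {..k}"
    with r have "r + i \<le> 3 * k" by simp
    from Cat_poly_dvd_fold[OF this, of c n]
    show "\<exists>h. ?V (N + i) - smult (\<sigma> i) (?V (\<tau> i)) = ?V k * h"
      unfolding N \<sigma>_def \<tau>_def add.assoc by (rule dvdE) blast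
  qed
  then obtain h where h: "\<And>i. i \<le> k \<Longrightarrow> ?V (N + i) - smult (\<sigma> i) (?V (\<tau> i)) = ?V k * h i"
    by (metis atMost_iff)
  have V: "?V (N + i) = smult (\<sigma> i) (?V (\<tau> i)) + ?V k * h i" if "i \<le> k" for i
    using h[OF that] by (simp add: algebra_simps)
  define \<eta> where "\<eta> i = poly (h i) 0" for i
  define \<rho> where "\<rho> i j = (if j = k then \<eta> i else if j = \<tau> i then \<sigma> i else 0)" for i j
  \<comment> \<open>Splitting off the constant term of the quotient by \<open>V\<^sub>k\<close> gives the residue modulo \<open>x V\<^sub>k\<close>.\<close>
  have "\<exists>t. h i = pCons (\<eta> i) t" for i
    unfolding \<eta>_def by (cases "h i") auto
  then obtain t where t: "\<And>i. h i = pCons (\<eta> i) (t i)"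
    by metis
  let ?q = "[:0, 1:] * ?V k"
  have residue: "orth_poly ?s (N + i) = (\<Sum>j<k + 1. smult (\<rho> i j) (?V j)) + ?q * t i"
    if i: "i < k + 1" for i
  proof -
    have \<tau>: "\<tau> i < k \<or> \<sigma> i = 0"
      using i r by (auto simp: \<tau>_def \<sigma>_def fold_index_def fold_sign_def)
    have "(\<Sum>j<k. smult (\<rho> i j) (?V j)) = (\<Sum>j<k. if j = \<tau> i then smult (\<sigma> i) (?V (\<tau> i)) else 0)"
      by (rule sum.cong) (auto simp: \<rho>_def)
    also have "\<dots> = smult (\<sigma> i) (?V (\<tau> i))"
      using \<tau> by auto
    finally have "(\<Sum>j<k + 1. smult (\<rho> i j) (?V j)) =
        smult (\<sigma> i) (?V (\<tau> i)) + smult (\<eta> i) (?V k)"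
      by (simp add: \<rho>_def)
    thus ?thesis
      using V[of i] i unfolding Cat_poly_def[symmetric] t by (simp add: algebra_simps)
  qed
  have "Cat 1 c (i + j + 1) k = Cat_coord ?s 0 (?q * monom 1 (i + j))" for i j
  proof -
    have "?q * monom 1 (i + j) = monom 1 (i + j + 1) * ?V k"
      by (simp add: monom_Suc)
    thus ?thesis
      unfolding Cat_poly_def Cat_def by (simp only: Cat_coord_eq_Cat_coord_0[symmetric] Cat_coord_monom)
  qed
  hence "det (mat N N (\<lambda>(i, j). Cat 1 c (i + j + 1) k)) =
      det (mat N N (\<lambda>(i, j). Cat_coord ?s 0 (?q * monom 1 (i + j))))"
    by simp
  also have "\<dots> = (- 1) ^ (N * (k + 1)) * det (mat (k + 1) (k + 1) (\<lambda>(i, j). \<rho> i j))"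
    using residue
  proof (rule det_hankel_eq_det_residues[rotated 4])
    have "?V k \<noteq> 0"
      using coeff_orth_poly_top[of ?s k] unfolding Cat_poly_def by fastforce
    thus "degree ?q = k + 1"
      by (subst degree_mult_eq) (auto simp: Cat_poly_def)
    show "lead_coeff ?q = 1"
      unfolding lead_coeff_mult by (simp add: Cat_poly_def)
  qed (simp_all add: Cat_poly_def)
  finally have det: "det (mat N N (\<lambda>(i, j). Cat 1 c (i + j + 1) k)) =
      (- 1) ^ (N * (k + 1)) * det (mat (k + 1) (k + 1) (\<lambda>(i, j). \<rho> i j))" .
  show thesis
  proof (rule that[of \<eta>])
    fix i assume "i \<le> k"
    thus "poly (?V (N + i)) 0 = (- 1) ^ n * fold_sign k (r + i) * poly (?V (fold_index k (r + i))) 0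
        + poly (?V k) 0 * \<eta> i"
      by (simp add: V \<eta>_def \<sigma>_def \<tau>_def)
  qed (use det in \<open>simp only: \<rho>_def \<sigma>_def \<tau>_def\<close>)
qed

lemma det_diag_last_col:
  fixes \<eta> :: "nat \<Rightarrow> 'a::comm_ring_1"
  shows "det (mat (k + 1) (k + 1) (\<lambda>(i, j). if j = k then \<eta> i else if j = i then a else 0)) = a ^ k * \<eta> k"
proof -
  let ?M = "mat (k + 1) (k + 1) (\<lambda>(i, j). if j = k then \<eta> i else if j = i then a else 0)"
  have "det ?M = prod_list (diag_mat ?M)"
    by (rule det_upper_triangular[of _ "k + 1"]) auto
  also have "diag_mat ?M = map (\<lambda>i. a) [0..<k] @ [\<eta> k]"
    by (auto simp: diag_mat_def)
  also have "prod_list \<dots> = a ^ k * \<eta> k"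
    by (induction k) (auto simp: map_replicate_const)
  finally show ?thesis .
qed

text \<open>In the last row \<open>k - 1 - k = 0\<close> by truncated subtraction, so the last two rows agree except in the
  last column; subtracting one from the other makes the matrix block triangular.\<close>

lemma det_antidiag_last_col:
  fixes \<eta> :: "nat \<Rightarrow> 'a::idom"
  assumes k: "k \<ge> 1"
  shows "det (mat (k + 1) (k + 1) (\<lambda>(i, j). if j = k then \<eta> i else if j = k - 1 - i then a else 0)) =
    (- 1) ^ (k choose 2) * a ^ k * (\<eta> k - \<eta> (k - 1))" (is "det ?M = _")
proof -
  let ?J = "mat k k (\<lambda>(i, j). if i + j + 1 = k then 1 else 0 :: 'a)"
  let ?x = "mat 1 1 (\<lambda>_. \<eta> k - \<eta> (k - 1))"
  have "det ?M = det (addrow (- 1) k (k - 1) ?M)"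
    using k by (subst det_addrow[of _ "k + 1"]) auto
  also have "addrow (- 1) k (k - 1) ?M =
      four_block_mat (a \<cdot>\<^sub>m ?J) (mat k 1 (\<lambda>(i, j). \<eta> i)) (0\<^sub>m 1 k) ?x"
    using k by (intro eq_matI) (auto simp: less_Suc_eq)
  also have "det \<dots> = det (a \<cdot>\<^sub>m ?J) * det ?x"
    by (rule det_four_block_mat_lower_left_zero) auto
  also have "det ?x = \<eta> k - \<eta> (k - 1)"
    by (subst det_single) auto
  also have "det (a \<cdot>\<^sub>m ?J) = a ^ k * (- 1) ^ (k choose 2)"
    unfolding det_smult det_antidiag by simp
  finally show ?thesis by (simp add: mult_ac)
qed

section \<open>Identities for the polynomials F and L\<close>

text \<open>The identities reflect \<open>F n = (z\<^sup>n - z\<^sup>-\<^sup>n) / (z - z\<^sup>-\<^sup>1)\<close> and \<open>L n = z\<^sup>n + z\<^sup>-\<^sup>n\<close> for \<open>c = z + z\<^sup>-\<^sup>1\<close>. The value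
  at \<open>c = 2\<close> serves to see that divisors do not vanish.\<close>

lemma poly_F_2: "poly (F n) 2 = int n"
  by (induction n rule: F.induct) auto

lemma F_add: "F (m + n + 1) = F (m + 1) * F (n + 1) - F m * F n"
proof (induction m rule: induct_nat_012)
  case (ge2 m)
  have "F (Suc (Suc m) + n + 1) = indet * F (Suc m + n + 1) - F (m + n + 1)"
    by simp
  also have "\<dots> = F (Suc (Suc m) + 1) * F (n + 1) - F (Suc (Suc m)) * F n"
    unfolding ge2 by (simp add: algebra_simps del: mult_pCons_left mult_pCons_right)
  finally show ?case .
qed simp_all

lemma F_diff: "F m = F (m + n) * F (n + 1) - F (m + n + 1) * F n"
  by (induction n) (simp_all add: algebra_simps del: mult_pCons_left mult_pCons_right)

text \<open>The left factor appears in the evaluation at \<open>0\<close> of the Chebyshev polynomials; together with its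
  instance \<open>m = 0\<close> this converts the quotients that the determinant produces, which have
  denominator \<open>F k + F (k + 1)\<close>, into quotients with denominator \<open>F (2 k + 1)\<close>.\<close>

lemma F_symmetric_sum:
  "(F (m + k) + F (m + k + 1)) * (F (k + 1) - F k) = F m + F (m + (2 * k + 1))"
  using F_add[of "m + k" k] F_diff[of m k] by (simp add: algebra_simps mult_2 mult_2_right)

lemma F_odd: "F (2 * k + 1) = (F k + F (k + 1)) * (F (k + 1) - F k)"
  using F_symmetric_sum[of 0 k] by simp

lemma L_eq_F: "L (n + 1) = F (n + 2) - F n"
proof (induction n rule: induct_nat_012)
  case (ge2 n)
  have "L (Suc (Suc n) + 1) = indet * L (Suc n + 1) - L (n + 1)"
    by simp
  also have "\<dots> = F (Suc (Suc n) + 2) - F (Suc (Suc n))"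
    unfolding ge2 by (simp add: algebra_simps del: mult_pCons_left mult_pCons_right)
  finally show ?case .
qed simp_all

lemma F_rec: "F (k + 2) = indet * F (k + 1) - F k"
  by simp

lemma L_sum_eq: "L k + L (k + 1) = (indet + 2) * (F (k + 1) - F k)"
proof (cases k)
  case (Suc l)
  show ?thesis
    using L_eq_F[of l] L_eq_F[of k] F_rec[of l] F_rec[of k] Suc
    by (simp add: algebra_simps del: mult_pCons_left mult_pCons_right)
qed (simp add: algebra_simps)

section \<open>Evaluation of the determinant\<close>

lemma poly_Cat_poly_0:
  "poly (Cat_poly indet m) 0 = (- 1) ^ m * (F m + F (m + 1))"
proof (induction m rule: induct_nat_012)
  case (ge2 m)
  have "poly (Cat_poly indet (Suc (Suc m))) 0 =
      - (indet * poly (Cat_poly indet (Suc m)) 0) - poly (Cat_poly indet m) 0"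
    by (simp add: Cat_poly_def)
  also have "\<dots> = (- 1) ^ Suc (Suc m) * (F (Suc (Suc m)) + F (Suc (Suc m) + 1))"
    unfolding ge2 by (simp add: algebra_simps del: mult_pCons_left mult_pCons_right)
  finally show ?case .
qed (simp_all add: Cat_poly_def)

lemma poly_Cat_poly_0_diff:
  "poly (Cat_poly indet (m + 1)) 0 - poly (Cat_poly indet m) 0 = - ((- 1) ^ m * (indet + 2) * F (m + 1))"
  unfolding poly_Cat_poly_0 by (simp add: algebra_simps del: mult_pCons_left mult_pCons_right)

text \<open>Multiplied by \<open>F (2 k + 1)\<close>, the formulas hold in \<open>\<int>[c]\<close>. The folded indices of the window
  \<open>r, \<dots>, r + k\<close> decide the case. For \<open>r = 0\<close> the window is \<open>0, \<dots>, k - 1\<close> and the zero at \<open>k\<close>, and the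
  residue matrix is triangular; \<open>r = k\<close> is its reversal. For \<open>r = k + 1\<close> the window folds to
  \<open>k - 1, \<dots>, 0, 0\<close>, so that the difference of the last two rows remains; \<open>r = 2 k\<close> is its reversal.
  Every other window meets too few folded indices for a nonzero determinant.\<close>

lemma Cat_hankel_det_cases:
  assumes N: "N = (2 * k + 1) * n + r" and r: "r \<le> 2 * k"
  defines "D \<equiv> Cat_hankel_det k N * F (2 * k + 1)"
    and "A \<equiv> F ((2 * k + 1) * n)" and "B \<equiv> F ((2 * k + 1) * (n + 1))"
    and "S \<equiv> L k + L (k + 1)"
  shows "r = 0 \<Longrightarrow> D = A + B"
    and "k \<ge> 1 \<Longrightarrow> r = k \<Longrightarrow> D = (- 1) ^ (k choose 2) * (A + B)"
    and "k \<ge> 1 \<Longrightarrow> r = k + 1 \<Longrightarrow> D = (- 1) ^ ((k + 1) choose 2) * S * B"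
    and "k \<ge> 1 \<Longrightarrow> r = 2 * k \<Longrightarrow> D = (- 1) ^ k * S * B"
    and "r \<notin> {0, k, k + 1, 2 * k} \<Longrightarrow> D = 0"
proof -
  define v where "v m = poly (Cat_poly indet m) 0" for m
  define \<sigma> :: "nat \<Rightarrow> int poly" where "\<sigma> i = (- 1) ^ n * fold_sign k (r + i)" for i
  define \<tau> where "\<tau> i = fold_index k (r + i)" for i
  obtain \<eta> where
    \<eta>: "\<And>i. i \<le> k \<Longrightarrow> v (N + i) = \<sigma> i * v (\<tau> i) + v k * \<eta> i" and
    det: "Cat_hankel_det k N = (- 1) ^ (N * (k + 1)) *
      det (mat (k + 1) (k + 1) (\<lambda>(i, j). if j = k then \<eta> i else if j = \<tau> i then \<sigma> i else 0))"
    using Cat_hankel_residues[OF N r, of indet]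
    unfolding Cat_hankel_det_def v_def \<sigma>_def \<tau>_def by blast
  let ?R = "\<lambda>i j. if j = k then \<eta> i else if j = \<tau> i then \<sigma> i else 0"
  let ?M = "mat (k + 1) (k + 1) (\<lambda>(i, j). ?R i j)"
  define u where "u = F k + F (k + 1)"
  define w where "w = F (k + 1) - F k"
  have "poly u 2 = 2 * int k + 1"
    by (simp add: u_def poly_F_2 del: F.simps)
  hence u: "u \<noteq> 0" by auto
  have vk: "v k = (- 1) ^ k * u"
    by (simp add: v_def u_def poly_Cat_poly_0)
  have odd: "F (2 * k + 1) = u * w"
    unfolding u_def w_def by (rule F_odd)
  have sum: "(F ((2 * k + 1) * n + k) + F ((2 * k + 1) * n + k + 1)) * w = A + B"
    unfolding A_def B_def w_def F_symmetric_sum by (simp add: algebra_simps)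
  have SB: "S * B = (indet + 2) * w * B"
    unfolding S_def w_def L_sum_eq ..
  \<comment> \<open>The determinant is only known after multiplication by \<open>v k\<close>, because the entries \<open>\<eta> i\<close> are
    determined by \<open>v k * \<eta> i\<close>; cancelling \<open>u\<close> replaces the denominator \<open>u\<close> by \<open>u * w\<close>.\<close>
  have D: "D = x * w" if "v k * Cat_hankel_det k N = (- 1) ^ k * x" for x
  proof -
    have "u * Cat_hankel_det k N = x"
      using that unfolding vk by (simp add: mult.assoc)
    thus ?thesis unfolding D_def odd by (simp add: mult_ac)
  qed
  have sign: "(- 1) ^ a = ((- 1) ^ b :: int poly)" if "even (a + b)" for a b
    using that by (auto simp: minus_one_power_iff)
  have choose: "Suc k choose 2 = (k choose 2) + k"
    by (simp add: numeral_2_eq_2)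

  have reverse: "det ?M =
      (- 1) ^ ((k + 1) choose 2) * det (mat (k + 1) (k + 1) (\<lambda>(i, j). ?R (k - i) j))"
    using det_reverse_rows[of "k + 1" ?R] unfolding add_diff_cancel_right' .

  show "D = A + B" if "r = 0"
  proof -
    have "?M = mat (k + 1) (k + 1) (\<lambda>(i, j). if j = k then \<eta> i else if j = i then (- 1) ^ n else 0)"
      using that by (intro eq_matI) (auto simp: \<tau>_def \<sigma>_def fold_index_def fold_sign_def)
    hence "det ?M = ((- 1) ^ n) ^ k * \<eta> k"
      by (simp only: det_diag_last_col)
    hence "v k * Cat_hankel_det k N = (- 1) ^ (N * (k + 1) + n * k) * (v k * \<eta> k)"
      by (simp only: det power_add power_mult) (simp only: mult_ac)
    also have "v k * \<eta> k = v (N + k)"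
      using \<eta>[of k] that by (simp add: \<sigma>_def fold_sign_def)
    also have "v (N + k) = (- 1) ^ (N + k) * (F ((2 * k + 1) * n + k) + F ((2 * k + 1) * n + k + 1))"
      using that by (simp only: v_def poly_Cat_poly_0 N add_0_right)
    finally have "v k * Cat_hankel_det k N = (- 1) ^ (N * (k + 1) + n * k + (N + k)) *
        (F ((2 * k + 1) * n + k) + F ((2 * k + 1) * n + k + 1))"
      by (simp only: power_add mult.assoc)
    also have "(- 1) ^ (N * (k + 1) + n * k + (N + k)) = ((- 1) ^ k :: int poly)"
      using that by (intro sign) (auto simp: N)
    finally show ?thesis
      by (simp only: D sum)
  qed

  show "D = (- 1) ^ (k choose 2) * (A + B)" if "k \<ge> 1" "r = k"
  proof -
    have "mat (k + 1) (k + 1) (\<lambda>(i, j). ?R (k - i) j) = mat (k + 1) (k + 1)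
        (\<lambda>(i, j). if j = k then \<eta> (k - i) else if j = i then (- 1) ^ (n + 1) else 0)"
      using that by (intro eq_matI) (auto simp: \<tau>_def \<sigma>_def fold_index_def fold_sign_def)
    hence "det (mat (k + 1) (k + 1) (\<lambda>(i, j). ?R (k - i) j)) = ((- 1) ^ (n + 1)) ^ k * \<eta> 0"
      by (simp only: det_diag_last_col diff_self_eq_0)
    hence "v k * Cat_hankel_det k N =
        (- 1) ^ (N * (k + 1) + ((k + 1) choose 2) + (n + 1) * k) * (v k * \<eta> 0)"
      by (simp only: det reverse power_add power_mult) (simp only: mult_ac)
    also have "v k * \<eta> 0 = v N"
      using \<eta>[of 0] that by (simp add: \<sigma>_def fold_sign_def)
    also have "v N = (- 1) ^ N * (F ((2 * k + 1) * n + k) + F ((2 * k + 1) * n + k + 1))"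
      using that by (simp only: v_def poly_Cat_poly_0 N)
    finally have "v k * Cat_hankel_det k N =
        (- 1) ^ (N * (k + 1) + ((k + 1) choose 2) + (n + 1) * k + N) *
        (F ((2 * k + 1) * n + k) + F ((2 * k + 1) * n + k + 1))"
      by (simp only: power_add mult.assoc)
    also have "(- 1) ^ (N * (k + 1) + ((k + 1) choose 2) + (n + 1) * k + N) =
        ((- 1) ^ (k + (k choose 2)) :: int poly)"
      using that by (intro sign) (auto simp: N choose)
    finally have "D = (- 1) ^ (k choose 2) * (F ((2 * k + 1) * n + k) + F ((2 * k + 1) * n + k + 1)) * w"
      by (intro D) (simp only: power_add mult.assoc)
    thus ?thesis by (simp only: sum mult.assoc)
  qed

  show "D = (- 1) ^ ((k + 1) choose 2) * S * B" if "k \<ge> 1" "r = k + 1"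
  proof -
    have "?M = mat (k + 1) (k + 1)
        (\<lambda>(i, j). if j = k then \<eta> i else if j = k - 1 - i then (- 1) ^ (n + 1) else 0)"
      using that by (intro eq_matI) (auto simp: \<tau>_def \<sigma>_def fold_index_def fold_sign_def)
    hence "det ?M = (- 1) ^ (k choose 2) * ((- 1) ^ (n + 1)) ^ k * (\<eta> k - \<eta> (k - 1))"
      by (simp only: det_antidiag_last_col[OF that(1)])
    hence "v k * Cat_hankel_det k N = (- 1) ^ (N * (k + 1) + (k choose 2) + (n + 1) * k) *
        (v k * \<eta> k - v k * \<eta> (k - 1))"
      by (simp only: det power_add power_mult right_diff_distrib[symmetric])
        (simp only: mult_ac)
    also have "v k * \<eta> k - v k * \<eta> (k - 1) = v (N + (k - 1) + 1) - v (N + (k - 1))"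
      using \<eta>[of k] \<eta>[of "k - 1"] that
      by (simp add: \<sigma>_def \<tau>_def fold_sign_def fold_index_def)
    also have "\<dots> = - ((- 1) ^ (N + (k - 1)) * (indet + 2) * F (N + (k - 1) + 1))"
      unfolding v_def by (rule poly_Cat_poly_0_diff)
    also have "N + (k - 1) + 1 = (2 * k + 1) * (n + 1)"
      using that by (simp add: N)
    also have "- ((- 1) ^ (N + (k - 1)) * (indet + 2) * F \<dots>) = (- 1) ^ (N + k) * ((indet + 2) * B)"
      using that(1) by (cases k) (simp_all add: B_def mult.assoc del: mult_pCons_left mult_pCons_right)
    finally have "v k * Cat_hankel_det k N =
        (- 1) ^ (N * (k + 1) + (k choose 2) + (n + 1) * k + (N + k)) * ((indet + 2) * B)"
      by (simp only: power_add mult.assoc)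
    also have "(- 1) ^ (N * (k + 1) + (k choose 2) + (n + 1) * k + (N + k)) =
        ((- 1) ^ (k + ((k + 1) choose 2)) :: int poly)"
      using that by (intro sign) (auto simp: N choose)
    finally have "D = (- 1) ^ ((k + 1) choose 2) * ((indet + 2) * B) * w"
      by (intro D) (simp only: power_add mult.assoc)
    also have "\<dots> = (- 1) ^ ((k + 1) choose 2) * (S * B)"
      unfolding SB by (simp only: mult_ac)
    finally show ?thesis by (simp only: mult.assoc)
  qed

  show "D = (- 1) ^ k * S * B" if "k \<ge> 1" "r = 2 * k"
  proof -
    have "mat (k + 1) (k + 1) (\<lambda>(i, j). ?R (k - i) j) = mat (k + 1) (k + 1)
        (\<lambda>(i, j). if j = k then \<eta> (k - i) else if j = k - 1 - i then (- 1) ^ (n + 1) else 0)"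
      using that by (intro eq_matI) (auto simp: \<tau>_def \<sigma>_def fold_index_def fold_sign_def)
    hence "det (mat (k + 1) (k + 1) (\<lambda>(i, j). ?R (k - i) j)) =
        (- 1) ^ (k choose 2) * ((- 1) ^ (n + 1)) ^ k * (\<eta> (k - k) - \<eta> (k - (k - 1)))"
      by (simp only: det_antidiag_last_col[OF that(1)])
    moreover have "k - k = 0" "k - (k - 1) = 1"
      using that by auto
    ultimately have "v k * Cat_hankel_det k N =
        (- 1) ^ (N * (k + 1) + ((k + 1) choose 2) + (k choose 2) + (n + 1) * k) *
        (v k * \<eta> 0 - v k * \<eta> 1)"
      by (simp only: det reverse power_add power_mult right_diff_distrib[symmetric])
        (simp only: mult_ac)
    also have "v k * \<eta> 0 - v k * \<eta> 1 = - (v (N + 1) - v N)"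
      using \<eta>[of 0] \<eta>[of 1] that
      by (simp add: \<sigma>_def \<tau>_def fold_sign_def fold_index_def)
    also have "\<dots> = (- 1) ^ N * (indet + 2) * F (N + 1)"
      unfolding v_def poly_Cat_poly_0_diff by simp
    also have "N + 1 = (2 * k + 1) * (n + 1)"
      using that by (simp add: N)
    finally have "v k * Cat_hankel_det k N =
        (- 1) ^ (N * (k + 1) + ((k + 1) choose 2) + (k choose 2) + (n + 1) * k + N) * ((indet + 2) * B)"
      unfolding B_def by (simp only: power_add mult.assoc)
    also have "(- 1) ^ (N * (k + 1) + ((k + 1) choose 2) + (k choose 2) + (n + 1) * k + N) =
        ((- 1) ^ (k + k) :: int poly)"
      using that by (intro sign) (auto simp: N choose)
    finally have "D = (- 1) ^ k * ((indet + 2) * B) * w"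
      by (intro D) (simp only: power_add mult.assoc)
    also have "\<dots> = (- 1) ^ k * (S * B)"
      unfolding SB by (simp only: mult_ac)
    finally show ?thesis by (simp only: mult.assoc)
  qed

  show "D = 0" if "r \<notin> {0, k, k + 1, 2 * k}"
  proof -
    from that r have "0 < r \<and> r < k \<or> k + 1 < r \<and> r < 2 * k" by auto
    then consider "0 < r" "r < k" | "k + 1 < r" "r < 2 * k" by blast
    hence "det ?M = 0"
    proof cases
      case 1
      \<comment> \<open>The window contains \<open>k - 1, k, k + 1\<close>, which fold to \<open>k - 1\<close>, zero, \<open>k - 1\<close>.\<close>
      define a where "a = k - r - 1"
      have a: "r = k - Suc a" "a + 2 \<le> k" using 1 by (auto simp: a_def)
      show ?thesis
        by (rule det_eq_0_if_zero_block[of _ "k + 1" "{a, a + 1, a + 2}" "{k - 1, k}"])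
          (use a in \<open>auto simp: \<tau>_def \<sigma>_def fold_index_def fold_sign_def\<close>)
    next
      case 2
      \<comment> \<open>The window contains \<open>2 k - 1, \<dots>, 2 k + 2\<close>, which fold to \<open>1, 0, 0, 1\<close>.\<close>
      define a where "a = 2 * k - r - 1"
      have a: "r = 2 * k - Suc a" "a + 3 \<le> k" using 2 by (auto simp: a_def)
      show ?thesis
        by (rule det_eq_0_if_zero_block[of _ "k + 1" "{a, a + 1, a + 2, a + 3}" "{0, 1, k}"])
          (use a in \<open>auto simp: \<tau>_def \<sigma>_def fold_index_def fold_sign_def card_insert_if\<close>)
    qed
    thus ?thesis unfolding D_def det by simp
  qed
qed

lemma to_fract_minus_one_power: "to_fract ((- 1) ^ n) = (- 1) ^ n"
  by (induction n) auto

theorem theorem1p7: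
  shows "(\<forall>(k::nat) (n::nat) (r::nat) (N::nat).
           k \<ge> 1 \<longrightarrow> N = (2 * k + 1) * n + r \<longrightarrow> r \<le> 2 * k \<longrightarrow>
           (let D = to_fract (Cat_hankel_det k N);
                A = to_fract (F ((2 * k + 1) * n)) / to_fract (F (2 * k + 1));
                B = to_fract (F ((2 * k + 1) * (n + 1))) / to_fract (F (2 * k + 1));
                S = to_fract (L k + L (k + 1))
            in (r = 0 \<longrightarrow> D = A + B) \<and>
               (r = k \<longrightarrow> D = (- 1) ^ (k choose 2) * (A + B)) \<and>
               (r = k + 1 \<longrightarrow> D = (- 1) ^ ((k + 1) choose 2) * S * B) \<and>
               (r = 2 * k \<longrightarrow> D = (- 1) ^ k * S * B) \<and>
               (r \<notin> {0, k, k + 1, 2 * k} \<longrightarrow> D = 0)))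
       \<and> (\<forall>n::nat. Cat_hankel_det 0 n = F n + F (n + 1))"
proof (intro conjI allI impI, goal_cases)
  case (1 k n r N)
  have "poly (F (2 * k + 1)) 2 \<noteq> 0"
    unfolding poly_F_2 by simp
  hence "F (2 * k + 1) \<noteq> 0" by auto
  hence *: "to_fract (Cat_hankel_det k N) = to_fract x / to_fract (F (2 * k + 1))"
    if "Cat_hankel_det k N * F (2 * k + 1) = x" for x
    using that by (simp add: nonzero_eq_divide_eq del: to_fract_mult flip: to_fract_mult)
  show ?case
    unfolding Let_def
    using Cat_hankel_det_cases[OF 1(2,3), THEN *] 1(1)
    by (simp add: to_fract_minus_one_power add_divide_distrib distrib_left)
next
  case (2 n)
  show ?case
    using Cat_hankel_det_cases(1)[of n 0 n 0] by simp
qed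

end
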